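(* Let $0<p<1$, $N\ge1$ an integer, $t\in\mathbb R$ and $m=Np+t$. If $|t|<Np$, then the series below converges and $$\sum_{k\ge1}\frac1{N^k}\cdot\frac{(-1)^kt^k}{k\,p^k}=-\log\Bigl(1+\frac t{Np}\Bigr)=-\log\frac m{Np}.$$ In truncated form: let $K\subset(0,1)$ and $H\subset\mathbb R$ be compact. For every integer $M\ge1$, as $N\to\infty$, uniformly for $p\in K$ and $t\in H$, $$\sum_{k=1}^{M}\frac1{N^k}\cdot\frac{(-1)^kt^k}{k\,p^k}=-\log\frac m{Np}+O\bigl(N^{-M-1}\bigr),$$ with an implied constant depending only on $M$, $K$ and $H$. *)

theory Defs
  imports "HOL-Analysis.Analysis"
begin

end

theory Submission
  imports Defs
begin

text \<open>With \<open>x = t / (N p)\<close> both claims concern the power series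
  \<open>- ln (1 + x) = (\<Sum>k\<ge>1. (- x)^k / k)\<close>. Its tail after \<open>M\<close> terms is dominated by a geometric
  series, hence at most \<open>2 \<bar>x\<bar>^(M + 1)\<close> for \<open>\<bar>x\<bar> \<le> 1/2\<close>; on compact parameter sets \<open>p\<close> is bounded
  away from 0 and \<open>t\<close> is bounded, so \<open>x = O(1/N)\<close> uniformly.\<close>

text \<open>The library's logarithm series with its sign flipped. Indexing from 0 is harmless: the
  term at \<open>n = 0\<close> is \<open>1 / 0\<close>, which is 0 in HOL.\<close>

lemma minus_ln_one_plus_sums:
  fixes x :: real
  assumes "\<bar>x\<bar> < 1"
  shows "(\<lambda>n. (- x) ^ n / real n) sums (- ln (1 + x))"
  using sums_minus[OF ln_series'[OF assms]] by simp

lemma minus_ln_one_plus_truncation: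
  fixes x :: real
  assumes "\<bar>x\<bar> \<le> 1 / 2"
  shows "\<bar>(\<Sum>k=1..M. (- x) ^ k / real k) - (- ln (1 + x))\<bar> \<le> 2 * \<bar>x\<bar> ^ (M + 1)"
proof -
  define f where "f n = (- x) ^ n / real n" for n
  have f: "f sums (- ln (1 + x))"
    unfolding f_def using assms by (intro minus_ln_one_plus_sums) auto
  \<comment> \<open>The initial segment of length \<open>M + 1\<close> contributes exactly the sum
    over \<open>1..M\<close>, since \<open>f 0 = 0\<close>.\<close>
  have "{..<M + 1} = insert 0 {1..M}" by auto
  then have init: "sum f {..<M + 1} = sum f {1..M}"
    by (simp add: f_def)
  have tail: "- ln (1 + x) = (\<Sum>n. f (n + (M + 1))) + sum f {..<M + 1}"
    using suminf_split_initial_segment[OF sums_summable[OF f], of "M + 1"] sums_unique[OF f]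
    by simp
  have geo: "(\<lambda>n. \<bar>x\<bar> ^ (M + 1) * \<bar>x\<bar> ^ n) sums (\<bar>x\<bar> ^ (M + 1) * (1 / (1 - \<bar>x\<bar>)))"
    using assms by (intro sums_mult geometric_sums) auto
  have "norm (f (n + (M + 1))) \<le> \<bar>x\<bar> ^ (M + 1) * \<bar>x\<bar> ^ n" for n
  proof -
    have "norm (f (n + (M + 1))) = \<bar>x\<bar> ^ (n + (M + 1)) / real (n + (M + 1))"
      by (simp only: f_def real_norm_def abs_divide power_abs abs_minus_cancel abs_of_nat)
    \<comment> \<open>The index is at least 1, so dropping the denominator leaves a geometric
      majorant.\<close>
    also have "\<dots> \<le> \<bar>x\<bar> ^ (n + (M + 1)) / 1"
      by (intro divide_left_mono) auto
    finally show ?thesis by (simp add: power_add mult_ac)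
  qed
  then have "norm (\<Sum>n. f (n + (M + 1))) \<le> (\<Sum>n. \<bar>x\<bar> ^ (M + 1) * \<bar>x\<bar> ^ n)"
    by (intro norm_suminf_le sums_summable[OF geo])
  also have "\<dots> = \<bar>x\<bar> ^ (M + 1) * (1 / (1 - \<bar>x\<bar>))"
    using sums_unique[OF geo] by simp
  \<comment> \<open>The factor 2 bounds \<open>1 / (1 - \<bar>x\<bar>)\<close> on
    \<open>\<bar>x\<bar> \<le> 1/2\<close>.\<close>
  also have "\<dots> \<le> \<bar>x\<bar> ^ (M + 1) * 2"
    using assms by (intro mult_left_mono) (auto simp: field_simps)
  finally have "\<bar>\<Sum>n. f (n + (M + 1))\<bar> \<le> 2 * \<bar>x\<bar> ^ (M + 1)"
    by (simp add: mult.commute)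
  moreover have "sum f {1..M} - (- ln (1 + x)) = - (\<Sum>n. f (n + (M + 1)))"
    using tail init by linarith
  ultimately have "\<bar>sum f {1..M} - (- ln (1 + x))\<bar> \<le> 2 * \<bar>x\<bar> ^ (M + 1)"
    by (simp only: abs_minus_cancel)
  then show ?thesis unfolding f_def .
qed

text \<open>Bridges the terms as printed in the theorem and the powers of \<open>- x\<close> with
  \<open>x = t / (n * p)\<close> used above; the sign \<open>(- 1) ^ k\<close> is absorbed into the
  base.\<close>

lemma series_term_eq:
  fixes n p t :: real
  shows "1 / n ^ k * ((- 1) ^ k * t ^ k / (real k * p ^ k)) = (- (t / (n * p))) ^ k / real k"
  by (subst power_minus) (simp add: power_divide power_mult_distrib)

theorem proposition2p3:
  shows "(\<forall>(N::nat) (p::real) (t::real) (m::real).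
            0 < p \<and> p < 1 \<and> 1 \<le> N \<and> m = real N * p + t \<and> \<bar>t\<bar> < real N * p \<longrightarrow>
              summable (\<lambda>j. let k = Suc j in
                1 / real N ^ k * ((-1) ^ k * t ^ k / (real k * p ^ k))) \<and>
              (\<Sum>j. let k = Suc j in
                1 / real N ^ k * ((-1) ^ k * t ^ k / (real k * p ^ k)))
                = - ln (1 + t / (real N * p)) \<and>
              - ln (1 + t / (real N * p)) = - ln (m / (real N * p)))
       \<and> (\<forall>(M::nat) (K::real set) (H::real set).
            1 \<le> M \<and> compact K \<and> K \<subseteq> {0<..<1} \<and> compact H \<longrightarrow>
              (\<exists>C::real. \<forall>\<^sub>F N::nat in sequentially. \<forall>p\<in>K. \<forall>t\<in>H. \<forall>m::real.
                 m = real N * p + t \<longrightarrow>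
                 \<bar>(\<Sum>k=1..M. 1 / real N ^ k * ((-1) ^ k * t ^ k / (real k * p ^ k)))
                   - (- ln (m / (real N * p)))\<bar> \<le> C * (1 / real N ^ (M + 1))))"
proof (rule conjI; intro allI impI; (elim conjE)?)
  fix N :: nat and p t m :: real
  assume "0 < p" "p < 1" "1 \<le> N" and m: "m = real N * p + t" and t: "\<bar>t\<bar> < real N * p"
  define x where "x = t / (real N * p)"
  have Np: "0 < real N * p" using t by linarith
  then have x: "\<bar>x\<bar> < 1"
    using t by (simp add: x_def abs_divide divide_less_eq)
  have ratio: "1 + t / (real N * p) = m / (real N * p)"
    using Np unfolding m by (metis add_divide_distrib divide_self less_irrefl)
  \<comment> \<open>Shifting the index by one drops only the vanishing zeroth term, so the sum is
    unchanged.\<close>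
  have "(\<lambda>j. (- x) ^ Suc j / real (Suc j)) sums (- ln (1 + x))"
    using minus_ln_one_plus_sums[OF x] by (subst sums_Suc_iff) simp
  then have ser: "(\<lambda>j. let k = Suc j in 1 / real N ^ k * ((-1) ^ k * t ^ k / (real k * p ^ k)))
      sums (- ln (1 + t / (real N * p)))"
    unfolding Let_def series_term_eq x_def .
  show "summable (\<lambda>j. let k = Suc j in
                1 / real N ^ k * ((-1) ^ k * t ^ k / (real k * p ^ k))) \<and>
              (\<Sum>j. let k = Suc j in
                1 / real N ^ k * ((-1) ^ k * t ^ k / (real k * p ^ k)))
                = - ln (1 + t / (real N * p)) \<and>
              - ln (1 + t / (real N * p)) = - ln (m / (real N * p))"
    by (intro conjI sums_summable[OF ser] sums_unique[OF ser, symmetric] arg_cong[OF ratio])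
next
  fix M :: nat and K H :: "real set"
  assume "1 \<le> M" and K: "compact K" "K \<subseteq> {0<..<1}" and "compact H"
  have "0 \<notin> K" using K(2) by auto
  \<comment> \<open>\<open>K\<close> is closed and misses 0, so it keeps a positive distance
    \<open>a\<close> from 0.\<close>
  then obtain a where a: "a > 0" "\<And>p. p \<in> K \<Longrightarrow> a \<le> \<bar>p\<bar>"
    using separate_point_closed[of K 0] K(1) compact_imp_closed[of K] by (auto simp: dist_real_def)
  obtain B where B: "B > 0" "\<And>t. t \<in> H \<Longrightarrow> \<bar>t\<bar> \<le> B"
    using compact_imp_bounded[OF \<open>compact H\<close>] by (auto simp: bounded_pos)
  show "\<exists>C::real. \<forall>\<^sub>F N::nat in sequentially. \<forall>p\<in>K. \<forall>t\<in>H. \<forall>m::real.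
                 m = real N * p + t \<longrightarrow>
                 \<bar>(\<Sum>k=1..M. 1 / real N ^ k * ((-1) ^ k * t ^ k / (real k * p ^ k)))
                   - (- ln (m / (real N * p)))\<bar> \<le> C * (1 / real N ^ (M + 1))"
  \<comment> \<open>Both choices come from \<open>\<bar>x\<bar> \<le> (B / a) / N\<close>: raising
    this to the power \<open>M + 1\<close> in the truncation bound gives the constant, and
    \<open>N \<ge> 2 * (B / a)\<close> forces \<open>\<bar>x\<bar> \<le> 1/2\<close>. Neither
    depends on \<open>p\<close> or \<open>t\<close>, which is the uniformity.\<close>
  proof (rule exI[of _ "2 * (B / a) ^ (M + 1)"],
      rule eventually_mono[OF eventually_ge_at_top[of "nat \<lceil>2 * (B / a)\<rceil>"]], intro ballI allI impI)
    fix N :: nat and p t m :: real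
    assume "nat \<lceil>2 * (B / a)\<rceil> \<le> N" and p: "p \<in> K" and t: "t \<in> H" and m: "m = real N * p + t"
    then have N: "2 * (B / a) \<le> real N" by linarith
    \<comment> \<open>As \<open>B\<close> is strictly positive, the threshold also excludes
      \<open>N = 0\<close>.\<close>
    moreover have "0 < B / a" using a(1) B(1) by simp
    ultimately have N0: "0 < real N" by linarith
    have ap: "a \<le> p" "0 < p" using a(2)[OF p] K(2) p by auto
    define x where "x = t / (real N * p)"
    have "\<bar>x\<bar> = \<bar>t\<bar> / (real N * p)" using N0 ap by (simp add: x_def abs_divide abs_mult)
    also have "\<dots> \<le> B / (real N * a)"
      using B(1) B(2)[OF t] N0 a(1) ap by (intro frac_le mult_left_mono) auto
    finally have x: "\<bar>x\<bar> \<le> B / a / real N" by (simp add: mult.commute)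
    have "B / a / real N \<le> 1 / 2" using N N0 by (subst pos_divide_le_eq) linarith+
    with x have "\<bar>x\<bar> \<le> 1 / 2" by linarith
    from minus_ln_one_plus_truncation[OF this]
    have "\<bar>(\<Sum>k=1..M. (- x) ^ k / real k) - (- ln (1 + x))\<bar> \<le> 2 * \<bar>x\<bar> ^ (M + 1)" .
    also have "\<dots> \<le> 2 * (B / a / real N) ^ (M + 1)"
      using x by (intro mult_left_mono power_mono) auto
    also have "\<dots> = 2 * (B / a) ^ (M + 1) * (1 / real N ^ (M + 1))"
      by (simp add: power_divide power_mult_distrib)
    finally have "\<bar>(\<Sum>k=1..M. (- x) ^ k / real k) - (- ln (1 + x))\<bar>
        \<le> 2 * (B / a) ^ (M + 1) * (1 / real N ^ (M + 1))" .
    moreover have "1 + x = m / (real N * p)"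
      using N0 ap by (simp add: x_def m add_divide_distrib)
    ultimately show "\<bar>(\<Sum>k=1..M. 1 / real N ^ k * ((-1) ^ k * t ^ k / (real k * p ^ k)))
        - (- ln (m / (real N * p)))\<bar> \<le> 2 * (B / a) ^ (M + 1) * (1 / real N ^ (M + 1))"
      unfolding series_term_eq x_def by simp
  qed
qed

end
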